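(* For every odd integer $r \ge 3$, every $r$-signotope is $2$-extendable.
   Context: For $r\ge 1$, an $r$-signotope on $[n]=\{1,\dots,n\}$ is a map $\sigma:\binom{[n]}{r}\to\{+,-\}$ such that for every $(r+1)$-subset $X=\{x_1<\dots<x_{r+1}\}$ of $[n]$ the sequence $\sigma(X_1),\sigma(X_2),\dots,\sigma(X_{r+1})$ has at most one sign change, where $X_j=X\setminus\{x_j\}$. An $r$-subset $F$ is a fliple of $\sigma$ if both assignments $+$ and $-$ to $\sigma(F)$ (keeping all other values) yield an $r$-signotope. For $k\in[n]$ and $X\subseteq[n]$ let $X\setminus\!\!\setminus k=\{x\in X: x<k\}\cup\{x-1: x\in X, x>k\}$. For an $r$-signotope $\sigma$ on $[n]$ and $k\in[n]$, the deletion $\sigma\setminus\!\!\setminus k$ is the $r$-signotope on $[n-1]$ defined by $(\sigma\setminus\!\!\setminus k)(X\setminus\!\!\setminus k)=\sigma(X)$ for all $r$-subsets $X\subseteq[n]$ with $k\notin X$. An $r$-signotope $\sigma$ on $[n]$ is $t$-extendable if for all pairwise disjoint $(r-1)$-subsets $I_1,\dots,I_t$ of $[n]$ there exist $k\in[n+1]$ and an $r$-signotope $\sigma^*$ on $[n+1]$ having fliples $I_1^*,\dots,I_t^*$ such that $\sigma^*\setminus\!\!\setminus k=\sigma$ and $I_j^*\setminus\!\!\setminus k=I_j$ for all $j=1,\dots,t$. *)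

theory Defs
  imports "HOL-Library.FuncSet" "HOL-Library.Ramsey" "HOL-Library.Disjoint_Sets"
begin

datatype sign = Plus | Minus

definition sign_changes :: "'a list \<Rightarrow> nat" where
  "sign_changes xs = card {i. Suc i < length xs \<and> xs ! i \<noteq> xs ! Suc i}"

(* A map on the r-subsets of [n] is an extensional function, so that equality of
   signotopes is plain equality. *)
definition signotope :: "nat \<Rightarrow> nat \<Rightarrow> (nat set \<Rightarrow> sign) \<Rightarrow> bool" where
  "signotope r n \<sigma> \<longleftrightarrow>
     \<sigma> \<in> nsets {1..n} r \<rightarrow>\<^sub>E UNIV \<and>
     (\<forall>X \<in> nsets {1..n} (Suc r).
        sign_changes (map (\<lambda>x. \<sigma> (X - {x})) (sorted_list_of_set X)) \<le> 1)"

definition fliple :: "nat \<Rightarrow> nat \<Rightarrow> (nat set \<Rightarrow> sign) \<Rightarrow> nat set \<Rightarrow> bool" where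
  "fliple r n \<sigma> F \<longleftrightarrow>
     F \<in> nsets {1..n} r \<and> signotope r n (\<sigma>(F := Plus)) \<and> signotope r n (\<sigma>(F := Minus))"

definition set_del :: "nat set \<Rightarrow> nat \<Rightarrow> nat set" where
  "set_del X k = {x \<in> X. x < k} \<union> {x - 1 | x. x \<in> X \<and> x > k}"

definition skip :: "nat \<Rightarrow> nat \<Rightarrow> nat" where
  "skip k y = (if y < k then y else Suc y)"

(* The image of Y below is the unique X with k \<notin> X and set_del X k = Y;
   see signotope_del_iff for the defining equation. *)
definition signotope_del ::
  "nat \<Rightarrow> nat \<Rightarrow> (nat set \<Rightarrow> sign) \<Rightarrow> nat \<Rightarrow> (nat set \<Rightarrow> sign)" where
  "signotope_del r n \<sigma> k =
     (\<lambda>Y \<in> nsets {1..n - 1} r. \<sigma> (skip k ` Y))"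

(* No condition k \<in> I' j is needed below: set_del (I' j) k has r - 1 elements only if
   k is one of the r elements of I' j. *)
definition extendable :: "nat \<Rightarrow> nat \<Rightarrow> nat \<Rightarrow> (nat set \<Rightarrow> sign) \<Rightarrow> bool" where
  "extendable t r n \<sigma> \<longleftrightarrow>
     (\<forall>I. (\<forall>j \<in> {1..t}. I j \<in> nsets {1..n} (r - 1)) \<and> disjoint_family_on I {1..t} \<longrightarrow>
        (\<exists>k \<in> {1..n + 1}. \<exists>\<sigma>' I'.
           signotope r (n + 1) \<sigma>' \<and>
           (\<forall>j \<in> {1..t}. fliple r (n + 1) \<sigma>' (I' j)) \<and>
           signotope_del r (n + 1) \<sigma>' k = \<sigma> \<and>
           (\<forall>j \<in> {1..t}. set_del (I' j) k = I j)))"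

lemma skip_neq: "skip k y \<noteq> k"
  by (simp add: skip_def)

lemma set_del_image:
  assumes "k \<ge> 1"
  shows "set_del (skip k ` Y) k = Y"
proof (rule set_eqI)
  fix y
  show "y \<in> set_del (skip k ` Y) k \<longleftrightarrow> y \<in> Y"
  proof
    assume "y \<in> set_del (skip k ` Y) k"
    then show "y \<in> Y" by (auto simp: set_del_def skip_def split: if_splits)
  next
    assume "y \<in> Y"
    then have *: "skip k y \<in> skip k ` Y" by blast
    show "y \<in> set_del (skip k ` Y) k"
    proof (cases "y < k")
      case True
      then show ?thesis using * by (simp add: set_del_def skip_def)
    next
      case False
      then have gt: "skip k y > k" and y: "skip k y - 1 = y" by (simp_all add: skip_def)
      have "skip k y - 1 \<in> set_del (skip k ` Y) k" using * gt unfolding set_del_def by blast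
      then show ?thesis by (simp only: y)
    qed
  qed
qed

lemma image_set_del:
  assumes "k \<notin> X"
  shows "skip k ` set_del X k = X"
proof (rule set_eqI)
  fix x
  show "x \<in> skip k ` set_del X k \<longleftrightarrow> x \<in> X"
  proof
    assume "x \<in> skip k ` set_del X k"
    then show "x \<in> X" by (auto simp: set_del_def skip_def split: if_splits)
  next
    assume x: "x \<in> X"
    then have "x \<noteq> k" using assms by blast
    then consider "x < k" | "x > k" by linarith
    then show "x \<in> skip k ` set_del X k"
    proof cases
      case 1
      then have "x \<in> set_del X k" "x = skip k x" using x by (auto simp: set_del_def skip_def)
      then show ?thesis by blast
    next
      case 2
      then have "x - 1 \<in> set_del X k" "x = skip k (x - 1)"
        using x by (auto simp: set_del_def skip_def)
      then show ?thesis by blast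
    qed
  qed
qed

lemma inj_skip: "inj_on (skip k) Y"
  by (auto simp: inj_on_def skip_def split: if_splits)

lemma set_del_nsets:
  assumes "X \<in> nsets {1..n} r" "k \<in> {1..n}" "k \<notin> X"
  shows "set_del X k \<in> nsets {1..n - 1} r"
proof -
  have X: "\<And>x. x \<in> X \<Longrightarrow> 1 \<le> x \<and> x \<le> n"
    using assms(1) unfolding nsets_def by auto
  have sub: "set_del X k \<subseteq> {1..n - 1}"
  proof
    fix y
    assume "y \<in> set_del X k"
    then consider "y \<in> X" "y < k" | x where "x \<in> X" "x > k" "y = x - 1"
      unfolding set_del_def by blast
    then show "y \<in> {1..n - 1}"
      using assms(2) X by cases force+
  qed
  have "card (set_del X k) = card X"
    using card_image[OF inj_skip, of k "set_del X k"] image_set_del[OF assms(3)] by simp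
  then show ?thesis
    using sub assms(1) finite_subset[OF sub] by (simp add: nsets_def)
qed

lemma signotope_del_iff:
  assumes k: "k \<in> {1..n}" and \<tau>: "\<tau> \<in> nsets {1..n - 1} r \<rightarrow>\<^sub>E UNIV"
  shows "signotope_del r n \<sigma> k = \<tau> \<longleftrightarrow>
         (\<forall>X \<in> nsets {1..n} r. k \<notin> X \<longrightarrow> \<tau> (set_del X k) = \<sigma> X)"
proof
  assume "signotope_del r n \<sigma> k = \<tau>"
  then have \<tau>: "\<tau> = signotope_del r n \<sigma> k" by simp
  show "\<forall>X \<in> nsets {1..n} r. k \<notin> X \<longrightarrow> \<tau> (set_del X k) = \<sigma> X"
  proof (intro ballI impI)
    fix X
    assume X: "X \<in> nsets {1..n} r" and kX: "k \<notin> X"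
    show "\<tau> (set_del X k) = \<sigma> X"
      unfolding \<tau> signotope_del_def restrict_apply'[OF set_del_nsets[OF X k kX]]
        image_set_del[OF kX] by (rule refl)
  qed
next
  assume *: "\<forall>X \<in> nsets {1..n} r. k \<notin> X \<longrightarrow> \<tau> (set_del X k) = \<sigma> X"
  show "signotope_del r n \<sigma> k = \<tau>"
  proof
    fix Y
    let ?X = "skip k ` Y"
    show "signotope_del r n \<sigma> k Y = \<tau> Y"
    proof (cases "Y \<in> nsets {1..n - 1} r")
      case True
      then have Y: "\<And>y. y \<in> Y \<Longrightarrow> 1 \<le> y \<and> y \<le> n - 1"
        unfolding nsets_def by auto
      have "?X \<subseteq> {1..n}"
      proof
        fix x
        assume "x \<in> ?X"
        then obtain y where "y \<in> Y" "x = skip k y" by blast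
        then show "x \<in> {1..n}" using Y[of y] k by (auto simp: skip_def)
      qed
      moreover have "card ?X = r" "finite ?X"
        using True card_image[OF inj_skip, of k Y] unfolding nsets_def by auto
      ultimately have X: "?X \<in> nsets {1..n} r" unfolding nsets_def by blast
      have kX: "k \<notin> ?X" by (metis imageE skip_neq)
      have "signotope_del r n \<sigma> k Y = \<sigma> ?X"
        unfolding signotope_del_def using True by (rule restrict_apply')
      also have "\<dots> = \<tau> (set_del ?X k)"
        using bspec[OF * X] kX by metis
      also have "set_del ?X k = Y"
        using k by (intro set_del_image) simp
      finally show ?thesis .
    next
      case False
      then have "signotope_del r n \<sigma> k Y = undefined"
        unfolding signotope_del_def restrict_def by (rule if_not_P)
      also have "\<dots> = \<tau> Y" using PiE_arb[OF \<tau> False] by (rule sym)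
      finally show ?thesis .
    qed
  qed
qed

end

theory Submission imports Defs begin

text \<open>Insert the new element between \<open>m\<close> and \<open>m + 1\<close>, and rotate the ground set so that \<open>m + 1\<close>
  comes first, negating the sign of a set once for each of its elements that is moved to the end.
  The one-element extensions at this position are the down-sets of a relation \<open>sweep m\<close> on
  \<open>(r - 1)\<close>-sets, and two sets become fliples of a common extension as soon as they are incomparable
  in its transitive closure: take everything strictly below one of them. Passing from \<open>m\<close> to \<open>m + 1\<close>
  only reverses the relation among the sets containing \<open>m + 1\<close>, and these sets form the middle one of
  three layers along which both relations are monotone. This yields acyclicity, and it shows that two
  disjoint sets cannot change from \<open>I\<close> below \<open>J\<close> to \<open>J\<close> below \<open>I\<close> in a single step. For odd \<open>r\<close> the
  full turn \<open>sweep n\<close> is the converse of \<open>sweep 0\<close>, so they are incomparable for some \<open>m\<close>.\<close>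

section \<open>Relations with a monotone layer function\<close>

lemma trancl_mono_layer:
  fixes l :: "'a \<Rightarrow> nat"
  assumes mono: "\<And>A B. (A, B) \<in> R \<Longrightarrow> l A \<le> l B" and AB: "(A, B) \<in> R\<^sup>+"
  shows "l A \<le> l B"
  using AB by induction (auto dest: mono intro: le_trans)

text \<open>A path along which \<open>l\<close> never decreases cannot leave a layer and return to
  it.\<close>

lemma trancl_constant_layer:
  fixes l :: "'a \<Rightarrow> nat"
  assumes mono: "\<And>A B. (A, B) \<in> R \<Longrightarrow> l A \<le> l B"
    and "(A, B) \<in> R\<^sup>+" "l A = l B"
  shows "(A, B) \<in> (R \<inter> {(C, D). l C = l A \<and> l D = l A})\<^sup>+"
  using assms(2,3)
proof induction
  case (base B)
  then show ?case by auto
next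
  case (step B C)
  have "l A \<le> l B" "l B \<le> l C"
    using trancl_mono_layer[of R l, OF mono] step.hyps by auto
  then have eq: "l A = l B" using step.prems by simp
  have "(B, C) \<in> R \<inter> {(C, D). l C = l A \<and> l D = l A}"
    using step.hyps(2) step.prems eq by auto
  with step.IH[OF eq] show ?case by (rule trancl_into_trancl)
qed

text \<open>Kept abstract because it is used in both directions, from \<open>sweep m\<close> to
  \<open>sweep (Suc m)\<close> and back. There \<open>E\<close> consists of the sets containing
  \<open>m + 1\<close>.\<close>

locale layered_swap =
  fixes R R' :: "('a \<times> 'a) set" and E :: "'a set" and l :: "'a \<Rightarrow> nat"
  assumes layer_E: "l A = 1 \<longleftrightarrow> A \<in> E"
    and mono: "(A, B) \<in> R \<Longrightarrow> l A \<le> l B"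
    and same: "\<not> (A \<in> E \<and> B \<in> E) \<Longrightarrow> (A, B) \<in> R' \<longleftrightarrow> (A, B) \<in> R"
    and swap: "A \<in> E \<Longrightarrow> B \<in> E \<Longrightarrow> (A, B) \<in> R' \<longleftrightarrow> (B, A) \<in> R"
begin

lemma mono': "(A, B) \<in> R' \<Longrightarrow> l A \<le> l B"
  using mono same layer_E by (metis order_refl)

text \<open>A cycle of a monotone relation stays in one layer. Layer 1 is \<open>E\<close>, where
  every edge is reversed and the cycle is run backwards; within any other layer nothing changes.
  \<open>S\<close> carries the agreements gained in earlier applications, and its symmetry lets it
  survive the reversal.\<close>

lemma cycle_transfer:
  assumes cyc: "(A, A) \<in> (R \<inter> S)\<^sup>+" and S: "sym S"
  shows "(A, A) \<in> (R' \<inter> (S \<inter> {(C, D). C \<in> E \<longleftrightarrow> D \<in> E}))\<^sup>+"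
proof -
  let ?T = "R' \<inter> (S \<inter> {(C, D). C \<in> E \<longleftrightarrow> D \<in> E})"
  let ?Q = "R \<inter> S \<inter> {(C, D). l C = l A \<and> l D = l A}"
  have Q: "(A, A) \<in> ?Q\<^sup>+"
    using trancl_constant_layer[of "R \<inter> S" l] cyc mono by blast
  show ?thesis
  proof (cases "A \<in> E")
    case True
    then have lA: "l A = 1" using layer_E by blast
    have "(C, D) \<in> ?T\<inverse>" if "(C, D) \<in> ?Q" for C D
      using that lA layer_E[of C] layer_E[of D] swap[of D C] symD[OF S, of C D] by simp
    then have "?Q \<subseteq> ?T\<inverse>" by (rule subrelI)
    then have "(A, A) \<in> (?T\<inverse>)\<^sup>+" using Q trancl_mono by blast
    then show ?thesis by (simp add: trancl_converse)
  next
    case False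
    then have lA: "l A \<noteq> 1" using layer_E by blast
    have "(C, D) \<in> ?T" if "(C, D) \<in> ?Q" for C D
      using that lA layer_E[of C] layer_E[of D] same[of C D] by simp
    then have "?Q \<subseteq> ?T" by (rule subrelI)
    then show ?thesis using Q trancl_mono by blast
  qed
qed

text \<open>The two paths force equal layers, and not layer 1, since one of the sets is outside
  \<open>E\<close>. Within that layer \<open>R'\<close> agrees with \<open>R\<close>, so the paths
  would close up to a cycle of \<open>R\<close>.\<close>

lemma no_reversal:
  assumes "acyclic R" "(A, B) \<in> R\<^sup>+" "(B, A) \<in> R'\<^sup>+" "\<not> (A \<in> E \<and> B \<in> E)"
  shows False
proof -
  have "l A \<le> l B" "l B \<le> l A"
    using trancl_mono_layer[of R l, OF mono] trancl_mono_layer[of R' l, OF mono'] assms by auto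
  then have eq: "l B = l A" by simp
  then have "A \<notin> E" "B \<notin> E" using assms(4) layer_E by metis+
  let ?Q = "R' \<inter> {(C, D). l C = l B \<and> l D = l B}"
  have Q: "(B, A) \<in> ?Q\<^sup>+"
    using trancl_constant_layer[of R' l B A, OF mono' assms(3) eq] .
  have lB: "l B \<noteq> 1" using \<open>B \<notin> E\<close> layer_E by blast
  have "(C, D) \<in> R" if "(C, D) \<in> ?Q" for C D
    using that lB layer_E[of C] layer_E[of D] same[of C D] by simp
  then have "?Q \<subseteq> R" by (rule subrelI)
  then have "(B, A) \<in> R\<^sup>+" using Q trancl_mono by blast
  then show False using assms(1,2) by (meson acyclic_def trancl_trans)
qed

end

section \<open>Sign sequences without alternation\<close>

lemma sign_eq_iff: "(s :: sign) = t \<longleftrightarrow> (s = Plus \<longleftrightarrow> t = Plus)"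
  by (cases s; cases t) auto

lemma sign_cases_neq: "(s :: sign) \<noteq> t \<Longrightarrow> v = s \<or> v = t"
  by (cases s; cases t; cases v) auto

lemma sign_change_between:
  assumes "i < j" "xs ! i \<noteq> xs ! j"
  obtains p where "i \<le> p" "p < j" "xs ! p \<noteq> xs ! Suc p"
proof -
  have "\<exists>p. i \<le> p \<and> p < j \<and> xs ! p \<noteq> xs ! Suc p"
  proof (rule ccontr)
    assume "\<not> ?thesis"
    then have step: "\<And>p. i \<le> p \<Longrightarrow> p < j \<Longrightarrow> xs ! Suc p = xs ! p" by metis
    have "i \<le> p \<Longrightarrow> p \<le> j \<Longrightarrow> xs ! p = xs ! i" for p
      by (induction p rule: dec_induct) (auto simp: step)
    then show False using assms by (metis less_imp_le order_refl)
  qed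
  then show ?thesis using that by blast
qed

lemma sign_changes_le_1_iff:
  fixes xs :: "sign list"
  shows "sign_changes xs \<le> 1 \<longleftrightarrow>
    (\<forall>i j k. i < j \<longrightarrow> j < k \<longrightarrow> k < length xs \<longrightarrow> xs ! i = xs ! k \<longrightarrow> xs ! j = xs ! i)"
proof -
  let ?C = "{i. Suc i < length xs \<and> xs ! i \<noteq> xs ! Suc i}"
  have fin: "finite ?C" by (rule finite_subset[of _ "{..<length xs}"]) auto
  have le1: "sign_changes xs \<le> 1 \<longleftrightarrow> (\<forall>p\<in>?C. \<forall>q\<in>?C. p = q)"
    unfolding sign_changes_def using card_le_Suc0_iff_eq[OF fin] by simp
  show ?thesis
  proof
    assume L: "sign_changes xs \<le> 1"
    show "\<forall>i j k. i < j \<longrightarrow> j < k \<longrightarrow> k < length xs \<longrightarrow> xs ! i = xs ! k \<longrightarrow> xs ! j = xs ! i"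
    proof (intro allI impI, rule ccontr)
      fix i j k
      assume *: "i < j" "j < k" "k < length xs" "xs ! i = xs ! k" "xs ! j \<noteq> xs ! i"
      obtain p where p: "i \<le> p" "p < j" "xs ! p \<noteq> xs ! Suc p"
        using sign_change_between[of i j xs] * by metis
      obtain q where q: "j \<le> q" "q < k" "xs ! q \<noteq> xs ! Suc q"
        using sign_change_between[of j k xs] * by metis
      have "p \<in> ?C" "q \<in> ?C" using p q * by auto
      then have "p = q" using L le1 by blast
      then show False using p q by simp
    qed
  next
    assume R: "\<forall>i j k. i < j \<longrightarrow> j < k \<longrightarrow> k < length xs \<longrightarrow> xs ! i = xs ! k \<longrightarrow> xs ! j = xs ! i"
    have no: False if "p < q" "p \<in> ?C" "q \<in> ?C" for p q
    proof -
      have C: "xs ! p \<noteq> xs ! Suc p" "xs ! q \<noteq> xs ! Suc q" "Suc q < length xs"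
        using that by auto
      show False
      proof (cases "xs ! q = xs ! p")
        case True
        then have "Suc p \<noteq> q" using C by auto
        then have "Suc p < q" using that by simp
        then have "xs ! Suc p = xs ! p"
          using R[rule_format, of p "Suc p" q] True C by simp
        then show False using C by simp
      next
        case False
        \<comment> \<open>With only two signs, two successive inequalities give an equality.\<close>
        then have "xs ! p = xs ! Suc q" using C sign_eq_iff by metis
        then have "xs ! q = xs ! p" using R[rule_format, of p q "Suc q"] that C by simp
        then show False using False by simp
      qed
    qed
    show "sign_changes xs \<le> 1"
      unfolding le1 using no by (meson linorder_neqE_nat)
  qed
qed

text \<open>The order is a parameter because it will be rotated. Signs are Boolean so that a twist
  by a parity is just \<open>\<noteq>\<close>, read as exclusive or.\<close>

definition alternation_free :: "(nat \<Rightarrow> nat \<Rightarrow> bool) \<Rightarrow> nat set \<Rightarrow> (nat \<Rightarrow> bool) \<Rightarrow> bool" where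
  "alternation_free L W s \<longleftrightarrow>
     (\<forall>a\<in>W. \<forall>b\<in>W. \<forall>c\<in>W. L a b \<longrightarrow> L b c \<longrightarrow> s a = s c \<longrightarrow> s b = s a)"

lemma alternation_freeD:
  "alternation_free L W s \<Longrightarrow> a \<in> W \<Longrightarrow> b \<in> W \<Longrightarrow> c \<in> W \<Longrightarrow> L a b \<Longrightarrow> L b c \<Longrightarrow> s a = s c
    \<Longrightarrow> s b = s a"
  unfolding alternation_free_def by blast

lemma alternation_free_negate:
  "alternation_free L W (\<lambda>a. s a \<noteq> p) \<longleftrightarrow> alternation_free L W s"
  unfolding alternation_free_def by (cases p) auto

lemma alternation_free_cong:
  "(\<And>a. a \<in> W \<Longrightarrow> s a = t a) \<Longrightarrow> alternation_free L W s \<longleftrightarrow> alternation_free L W t"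
  unfolding alternation_free_def by simp

lemma alternation_free_image:
  assumes "\<And>x y. x \<in> X \<Longrightarrow> y \<in> X \<Longrightarrow> L (f x) (f y) \<longleftrightarrow> L' x y"
  shows "alternation_free L (f ` X) s \<longleftrightarrow> alternation_free L' X (s \<circ> f)"
  using assms unfolding alternation_free_def by auto

lemma signotope_iff:
  "signotope r n \<sigma> \<longleftrightarrow> \<sigma> \<in> nsets {1..n} r \<rightarrow>\<^sub>E UNIV \<and>
     (\<forall>X \<in> nsets {1..n} (Suc r). alternation_free (<) X (\<lambda>x. \<sigma> (X - {x}) = Plus))"
proof -
  have "sign_changes (map (\<lambda>x. \<sigma> (X - {x})) (sorted_list_of_set X)) \<le> 1 \<longleftrightarrow>
      alternation_free (<) X (\<lambda>x. \<sigma> (X - {x}) = Plus)" (is "?l \<longleftrightarrow> ?r")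
    if X: "X \<in> nsets {1..n} (Suc r)" for X
  proof -
    let ?L = "sorted_list_of_set X"
    have fin: "finite X" using X by (simp add: nsets_def)
    have set: "set ?L = X" using fin by simp
    have less: "?L ! i < ?L ! j \<longleftrightarrow> i < j" if "i < length ?L" "j < length ?L" for i j
      using strict_sorted_list_of_set[of X] that
      by (metis linorder_neqE_nat order_less_asym order_less_irrefl sorted_wrt_iff_nth_less)
    let ?P = "\<lambda>a b c. a < b \<longrightarrow> b < c \<longrightarrow> \<sigma> (X - {a}) = \<sigma> (X - {c})
                 \<longrightarrow> \<sigma> (X - {b}) = \<sigma> (X - {a})"
    have "?l \<longleftrightarrow> (\<forall>i<length ?L. \<forall>j<length ?L. \<forall>k<length ?L. ?P (?L ! i) (?L ! j) (?L ! k))"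
      unfolding sign_changes_le_1_iff
      by (auto simp: less) (meson less_trans)
    also have "\<dots> \<longleftrightarrow> (\<forall>a\<in>set ?L. \<forall>b\<in>set ?L. \<forall>c\<in>set ?L. ?P a b c)"
      by (simp only: all_set_conv_all_nth)
    also have "\<dots> \<longleftrightarrow> ?r"
      unfolding set alternation_free_def by (simp add: sign_eq_iff[symmetric])
    finally show ?thesis .
  qed
  then show ?thesis unfolding signotope_def by simp
qed

section \<open>Rotating the ground set\<close>

text \<open>The order \<open>m + 1, m + 2, \<dots>, 1, \<dots>, m\<close>.\<close>

definition rot_less :: "nat \<Rightarrow> nat \<Rightarrow> nat \<Rightarrow> bool" where
  "rot_less m x y \<longleftrightarrow> (x < y) \<noteq> ((x \<le> m) \<noteq> (y \<le> m))"

definition parity :: "nat \<Rightarrow> nat set \<Rightarrow> bool" where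
  "parity m X \<longleftrightarrow> odd (card (X \<inter> {..m}))"

text \<open>Moving the first of three entries to the end and negating it turns the alternating
  triple + - + into - + -. So cyclic shifts with negation neither create nor destroy
  alternation.\<close>

lemma alternation_free_rotate:
  "alternation_free (rot_less m) W (\<lambda>a. s a \<noteq> (a \<le> m)) \<longleftrightarrow> alternation_free (<) W s"
proof
  assume *: "alternation_free (<) W s"
  show "alternation_free (rot_less m) W (\<lambda>a. s a \<noteq> (a \<le> m))"
    unfolding alternation_free_def
  proof (intro ballI impI)
    fix a b c
    assume W: "a \<in> W" "b \<in> W" "c \<in> W" and L: "rot_less m a b" "rot_less m b c"
      and eq: "(s a \<noteq> (a \<le> m)) = (s c \<noteq> (c \<le> m))"
    \<comment> \<open>The cases tell which of the three were moved to the end: all or none,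
      \<open>b\<close> and \<open>c\<close>, or only \<open>c\<close>. Each triple is put back into
      its natural order.\<close>
    from L consider "a < b" "b < c" "a \<le> m \<longleftrightarrow> b \<le> m" "b \<le> m \<longleftrightarrow> c \<le> m"
      | "b < c" "c < a" "\<not> a \<le> m" "b \<le> m" "c \<le> m"
      | "c < a" "a < b" "\<not> a \<le> m" "\<not> b \<le> m" "c \<le> m"
      unfolding rot_less_def by linarith
    then show "(s b \<noteq> (b \<le> m)) = (s a \<noteq> (a \<le> m))"
    proof cases
      case 1
      then show ?thesis using alternation_freeD[OF * W] eq by blast
    next
      case 2
      then show ?thesis using alternation_freeD[OF * W(2,3,1)] eq by blast
    next
      case 3
      then show ?thesis using alternation_freeD[OF * W(3,1,2)] eq by blast
    qed
  qed
next
  assume *: "alternation_free (rot_less m) W (\<lambda>a. s a \<noteq> (a \<le> m))"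
  show "alternation_free (<) W s"
    unfolding alternation_free_def
  proof (intro ballI impI)
    fix a b c
    assume W: "a \<in> W" "b \<in> W" "c \<in> W" and L: "a < b" "b < c" and eq: "s a = s c"
    from L consider "rot_less m a b" "rot_less m b c" "a \<le> m \<longleftrightarrow> b \<le> m" "b \<le> m \<longleftrightarrow> c \<le> m"
      | "rot_less m b c" "rot_less m c a" "a \<le> m" "\<not> b \<le> m" "\<not> c \<le> m"
      | "rot_less m c a" "rot_less m a b" "a \<le> m" "b \<le> m" "\<not> c \<le> m"
      unfolding rot_less_def by linarith
    then show "s b = s a"
    proof cases
      case 1
      then show ?thesis using alternation_freeD[OF * W] eq by blast
    next
      case 2
      then show ?thesis using alternation_freeD[OF * W(2,3,1)] eq by blast
    next
      case 3
      then show ?thesis using alternation_freeD[OF * W(3,1,2)] eq by blast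
    qed
  qed
qed

text \<open>Negating \<open>W - {a}\<close> once per moved element is the twist
  \<open>a \<le> m\<close> of \<open>alternation_free_rotate\<close> up to the global sign
  \<open>parity m W\<close>, which \<open>alternation_free_negate\<close> absorbs.\<close>

lemma parity_remove:
  assumes "finite W" "a \<in> W"
  shows "parity m (W - {a}) \<longleftrightarrow> parity m W \<noteq> (a \<le> m)"
proof (cases "a \<le> m")
  case True
  have "W \<inter> {..m} = insert a ((W - {a}) \<inter> {..m})" using True assms by auto
  then have "card (W \<inter> {..m}) = Suc (card ((W - {a}) \<inter> {..m}))"
    using assms by (simp add: card_insert_if)
  then show ?thesis using True by (simp add: parity_def)
next
  case False
  then have "W \<inter> {..m} = (W - {a}) \<inter> {..m}" by auto
  then show ?thesis using False by (simp add: parity_def)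
qed

lemma parity_Suc:
  assumes "finite W"
  shows "parity (Suc m) W \<longleftrightarrow> parity m W \<noteq> (Suc m \<in> W)"
proof (cases "Suc m \<in> W")
  case True
  have "W \<inter> {..Suc m} = insert (Suc m) (W \<inter> {..m})" using True by (auto simp: le_Suc_eq)
  then have "card (W \<inter> {..Suc m}) = Suc (card (W \<inter> {..m}))"
    using assms by (simp add: card_insert_if)
  then show ?thesis using True by (simp add: parity_def)
next
  case False
  then have "W \<inter> {..Suc m} = W \<inter> {..m}" by (auto simp: le_Suc_eq)
  then show ?thesis using False by (simp add: parity_def)
qed

lemma rot_less_Suc:
  "x \<noteq> y \<Longrightarrow> rot_less (Suc m) x y \<longleftrightarrow> rot_less m x y \<noteq> (x = Suc m \<or> y = Suc m)"
  unfolding rot_less_def by (auto simp: le_Suc_eq)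

lemma rot_less_total: "x \<noteq> y \<Longrightarrow> rot_less m y x \<longleftrightarrow> \<not> rot_less m x y"
  unfolding rot_less_def by auto

lemma rot_less_first: "y \<noteq> Suc m \<Longrightarrow> rot_less m (Suc m) y"
  unfolding rot_less_def by auto

section \<open>The relation whose down-sets are the one-element extensions\<close>

locale signotope_on =
  fixes r n :: nat and \<sigma> :: "nat set \<Rightarrow> sign"
  assumes signotope: "signotope r n \<sigma>"
begin

definition rot_sign :: "nat \<Rightarrow> nat set \<Rightarrow> bool" where
  "rot_sign m X \<longleftrightarrow> (\<sigma> X = Plus) \<noteq> parity m X"

text \<open>Adjoin the new element to \<open>X\<close>, as first in the rotated order. The sign
  sequence then starts with \<open>rot_sign m X\<close>, so the \<open>x\<close> with
  \<open>X - {x}\<close> in the down-set must form an initial segment of \<open>X\<close> if this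
  sign is plus, and a final one if it is minus. The pairs are these closure conditions.\<close>

definition sweep :: "nat \<Rightarrow> (nat set \<times> nat set) set" where
  "sweep m = {(X - {x}, X - {y}) | X x y.
     X \<in> nsets {1..n} r \<and> x \<in> X \<and> y \<in> X \<and> x \<noteq> y \<and> (rot_sign m X \<longleftrightarrow> rot_less m x y)}"

lemma sweepI:
  "X \<in> nsets {1..n} r \<Longrightarrow> x \<in> X \<Longrightarrow> y \<in> X \<Longrightarrow> x \<noteq> y \<Longrightarrow> rot_sign m X \<longleftrightarrow> rot_less m x y
    \<Longrightarrow> (X - {x}, X - {y}) \<in> sweep m"
  unfolding sweep_def by blast

lemma sweepE:
  assumes "(A, B) \<in> sweep m"
  obtains X x y where "X \<in> nsets {1..n} r" "x \<in> X" "y \<in> X" "x \<noteq> y"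
    "rot_sign m X \<longleftrightarrow> rot_less m x y" "A = X - {x}" "B = X - {y}"
  using assms unfolding sweep_def by blast

lemma sweep_neq: "(A, B) \<in> sweep m \<Longrightarrow> A \<noteq> B"
  by (auto elim!: sweepE)

lemma sweep_subset: "(A, B) \<in> sweep m \<Longrightarrow> A \<subseteq> {1..n} \<and> B \<subseteq> {1..n}"
  by (elim sweepE) (auto simp: nsets_def)

section \<open>Passing from one rotation to the next\<close>

lemma rot_sign_Suc:
  "X \<in> nsets {1..n} r \<Longrightarrow> rot_sign (Suc m) X \<longleftrightarrow> rot_sign m X \<noteq> (Suc m \<in> X)"
  unfolding rot_sign_def by (auto simp: parity_Suc nsets_def)

text \<open>If \<open>m + 1\<close> is in \<open>X\<close> but not in both sets, it is
  \<open>x\<close> or \<open>y\<close>; then \<open>rot_sign\<close> and \<open>rot_less\<close>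
  both flip and the changes cancel.\<close>

lemma sweep_Suc_same:
  assumes "\<not> (Suc m \<in> A \<and> Suc m \<in> B)"
  shows "(A, B) \<in> sweep (Suc m) \<longleftrightarrow> (A, B) \<in> sweep m"
proof
  assume "(A, B) \<in> sweep (Suc m)"
  then show "(A, B) \<in> sweep m"
  proof (cases rule: sweepE)
    case (1 X x y)
    then show ?thesis
      using assms sweepI[of X x y m] rot_sign_Suc[of X m] rot_less_Suc[of x y m] by auto
  qed
next
  assume "(A, B) \<in> sweep m"
  then show "(A, B) \<in> sweep (Suc m)"
  proof (cases rule: sweepE)
    case (1 X x y)
    then show ?thesis
      using assms sweepI[of X x y "Suc m"] rot_sign_Suc[of X m] rot_less_Suc[of x y m] by auto
  qed
qed

text \<open>Here \<open>m + 1\<close> is in \<open>X\<close> but is neither \<open>x\<close> nor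
  \<open>y\<close>, so only \<open>rot_sign\<close> flips.\<close>

lemma sweep_Suc_swap:
  assumes "Suc m \<in> A" "Suc m \<in> B"
  shows "(A, B) \<in> sweep (Suc m) \<longleftrightarrow> (B, A) \<in> sweep m"
proof
  assume "(A, B) \<in> sweep (Suc m)"
  then show "(B, A) \<in> sweep m"
  proof (cases rule: sweepE)
    case (1 X x y)
    have "Suc m \<in> X" "x \<noteq> Suc m" "y \<noteq> Suc m" using assms 1(6,7) by auto
    then have "rot_sign m X \<longleftrightarrow> rot_less m y x"
      using 1(5) rot_sign_Suc[OF 1(1), of m] rot_less_Suc[OF 1(4)] rot_less_total[OF 1(4)] by blast
    then show ?thesis unfolding 1(6,7) using 1(1-4) by (intro sweepI) auto
  qed
next
  assume "(B, A) \<in> sweep m"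
  then show "(A, B) \<in> sweep (Suc m)"
  proof (cases rule: sweepE)
    case (1 X x y)
    have "Suc m \<in> X" "x \<noteq> Suc m" "y \<noteq> Suc m" using assms 1(6,7) by auto
    then have "rot_sign (Suc m) X \<longleftrightarrow> rot_less (Suc m) y x"
      using 1(5) rot_sign_Suc[OF 1(1), of m] rot_less_Suc[OF 1(4)] rot_less_total[OF 1(4)] by blast
    then show ?thesis unfolding 1(6,7) using 1(1-4) by (intro sweepI) auto
  qed
qed

text \<open>Geometrically, the layer of \<open>A\<close> records whether the vertex \<open>A\<close> lies before, on, or
  after the pseudohyperplane \<open>m + 1\<close>.\<close>

definition layer :: "nat \<Rightarrow> nat set \<Rightarrow> nat" where
  "layer m A = (if Suc m \<in> A then 1 else if rot_sign m (insert (Suc m) A) then 0 else 2)"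

text \<open>If \<open>m + 1\<close> is in \<open>X\<close>, its being first in the rotated order
  decides on which side \<open>X - {m + 1}\<close> lies. Otherwise the signotope axiom is applied to
  \<open>X\<close> with \<open>m + 1\<close> added: its rotated sequence starts with
  \<open>rot_sign m X\<close>, the sign that also directs the edge, and a drop in layer would be an
  alternation.\<close>

lemma sweep_layer_mono:
  assumes m: "m < n" and AB: "(A, B) \<in> sweep m"
  shows "layer m A \<le> layer m B"
  using AB
proof (cases rule: sweepE)
  case (1 X x y)
  let ?e = "Suc m"
  have finX: "finite X" and cX: "card X = r" and XN: "X \<subseteq> {1..n}"
    using 1 by (auto simp: nsets_def)
  show ?thesis
  proof (cases "?e \<in> X")
    case True
    consider "x = ?e" | "y = ?e" | "x \<noteq> ?e" "y \<noteq> ?e" by blast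
    then show ?thesis
    proof cases
      case 1
      then show ?thesis
        using \<open>x \<noteq> y\<close> \<open>A = _\<close> \<open>B = _\<close> \<open>y \<in> X\<close> True \<open>rot_sign m X \<longleftrightarrow> _\<close> rot_less_first[of y m]
        by (auto simp: layer_def insert_absorb)
    next
      case 2
      then show ?thesis
        using \<open>x \<noteq> y\<close> \<open>A = _\<close> \<open>B = _\<close> \<open>x \<in> X\<close> True \<open>rot_sign m X \<longleftrightarrow> _\<close> rot_less_first[of x m]
          rot_less_total[of x y m]
        by (auto simp: layer_def insert_absorb)
    next
      case 3
      then show ?thesis using True \<open>A = _\<close> \<open>B = _\<close> by (simp add: layer_def)
    qed
  next
    case False
    let ?W = "insert ?e X"
    have W: "?W \<in> nsets {1..n} (Suc r)"
      using False finX cX XN m by (auto simp: nsets_def)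
    then have "alternation_free (<) ?W (\<lambda>a. \<sigma> (?W - {a}) = Plus)"
      using signotope unfolding signotope_iff by blast
    then have "alternation_free (rot_less m) ?W
        (\<lambda>a. ((\<sigma> (?W - {a}) = Plus) \<noteq> (a \<le> m)) \<noteq> parity m ?W)"
      unfolding alternation_free_negate alternation_free_rotate .
    then have af: "alternation_free (rot_less m) ?W (\<lambda>a. rot_sign m (?W - {a}))"
      by (rule iffD1[OF alternation_free_cong, rotated])
        (use finX in \<open>auto simp: rot_sign_def parity_remove simp del: insert_iff\<close>)
    have We: "?W - {?e} = X" "?W - {x} = insert ?e A" "?W - {y} = insert ?e B"
      using False 1 by auto
    have e: "?e \<notin> A" "?e \<notin> B" "x \<noteq> ?e" "y \<noteq> ?e" using False 1 by auto
    have fst: "rot_less m ?e x" "rot_less m ?e y" using e rot_less_first by auto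
    have "\<not> (rot_sign m (insert ?e B) \<and> \<not> rot_sign m (insert ?e A))"
      using alternation_freeD[OF af, of ?e x y] alternation_freeD[OF af, of ?e y x] fst
        1(2-5) rot_less_total[of x y m] unfolding We by auto
    then show ?thesis using e by (auto simp: layer_def)
  qed
qed

section \<open>Acyclicity for every rotation\<close>

lemma layered_swap_sweep:
  assumes "m < n"
  shows "layered_swap (sweep m) (sweep (Suc m)) {A. Suc m \<in> A} (layer m)"
  using sweep_layer_mono[OF assms] sweep_Suc_same sweep_Suc_swap
  by unfold_locales (auto simp: layer_def)

lemma layered_swap_sweep':
  assumes "m < n"
  shows "layered_swap (sweep (Suc m)) (sweep m) {A. Suc m \<in> A} (layer m)"
proof -
  interpret layered_swap "sweep m" "sweep (Suc m)" "{A. Suc m \<in> A}" "layer m"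
    by (rule layered_swap_sweep[OF assms])
  show ?thesis using mono' same swap layer_E by unfold_locales auto
qed

text \<open>By \<open>cycle_transfer\<close>, all sets on a cycle agree on whether they contain \<open>1\<close>, then, passing to
  the next rotation, on whether they contain \<open>2\<close>, and so on; hence they are all equal.\<close>

lemma acyclic_sweep_0: "acyclic (sweep 0)"
  unfolding acyclic_def
proof (intro allI notI)
  fix A
  assume cyc: "(A, A) \<in> (sweep 0)\<^sup>+"
  have "m \<le> n \<Longrightarrow> (A, A) \<in> (sweep m \<inter> {(C, D). C \<inter> {1..m} = D \<inter> {1..m}})\<^sup>+" for m
  proof (induction m)
    case 0
    then show ?case using cyc by simp
  next
    case (Suc m)
    let ?S = "{(C :: nat set, D). C \<inter> {1..m} = D \<inter> {1..m}}"
    let ?S' = "{(C :: nat set, D). C \<inter> {1..Suc m} = D \<inter> {1..Suc m}}"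
    interpret layered_swap "sweep m" "sweep (Suc m)" "{A. Suc m \<in> A}" "layer m"
      using layered_swap_sweep Suc.prems by simp
    have "sym ?S" by (auto simp: sym_def)
    with Suc have "(A, A) \<in> (sweep (Suc m) \<inter>
        (?S \<inter> {(C, D). C \<in> {A. Suc m \<in> A} \<longleftrightarrow> D \<in> {A. Suc m \<in> A}}))\<^sup>+"
      by (intro cycle_transfer) auto
    moreover have "?S \<inter> {(C, D). C \<in> {A. Suc m \<in> A} \<longleftrightarrow> D \<in> {A. Suc m \<in> A}} \<subseteq> ?S'"
      by (auto simp: atLeastAtMostSuc_conv)
    ultimately show ?case
      by (meson Int_mono order_refl trancl_mono)
  qed
  from this[of n] have "(A, A) \<in> (sweep n \<inter> {(C, D). C \<inter> {1..n} = D \<inter> {1..n}})\<^sup>+" by simp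
  then obtain B where "(A, B) \<in> sweep n" "A \<inter> {1..n} = B \<inter> {1..n}"
    by (auto elim: converse_tranclE)
  then show False using sweep_neq sweep_subset by (metis inf.absorb1)
qed

text \<open>The swap is read backwards here, pulling a cycle of \<open>sweep (Suc m)\<close> back to
  one of \<open>sweep m\<close>.\<close>

lemma acyclic_sweep: "m \<le> n \<Longrightarrow> acyclic (sweep m)"
proof (induction m)
  case 0
  then show ?case by (simp add: acyclic_sweep_0)
next
  case (Suc m)
  interpret layered_swap "sweep (Suc m)" "sweep m" "{A. Suc m \<in> A}" "layer m"
    using layered_swap_sweep' Suc.prems by simp
  show ?case
    unfolding acyclic_def
  proof (intro allI notI)
    fix A
    assume "(A, A) \<in> (sweep (Suc m))\<^sup>+"
    then have "(A, A) \<in> (sweep (Suc m) \<inter> UNIV)\<^sup>+" by simp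
    then have "(A, A) \<in> (sweep m \<inter> (UNIV \<inter> {(C, D). C \<in> {A. Suc m \<in> A} \<longleftrightarrow> D \<in> {A. Suc m \<in> A}}))\<^sup>+"
      by (rule cycle_transfer) (simp add: sym_def)
    then have "(A, A) \<in> (sweep m)\<^sup>+" by (rule trancl_mono) auto
    then show False using Suc by (simp add: acyclic_def)
  qed
qed

section \<open>The full turn and incomparability of disjoint sets\<close>

text \<open>After the full turn the order on \<open>{1..n}\<close> is the natural one again, while
  each \<open>r\<close>-set has been negated \<open>r\<close> times, an odd number.\<close>

lemma sweep_n:
  assumes "odd r"
  shows "sweep n = (sweep 0)\<inverse>"
proof -
  have "(A, B) \<in> sweep n \<longleftrightarrow> (B, A) \<in> sweep 0" for A B
  proof -
    have s: "rot_sign n X \<longleftrightarrow> \<not> rot_sign 0 X" if "X \<in> nsets {1..n} r" for X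
    proof -
      have "X \<inter> {..n} = X" "X \<inter> {..0} = {}" using that by (auto simp: nsets_def)
      then show ?thesis using that assms by (simp add: rot_sign_def parity_def nsets_def)
    qed
    have l: "rot_less n x y \<longleftrightarrow> x < y" "rot_less 0 x y \<longleftrightarrow> x < y"
      if "X \<in> nsets {1..n} r" "x \<in> X" "y \<in> X" for X x y
      using that by (auto simp: rot_less_def nsets_def)
    have eq: "(rot_sign n X \<longleftrightarrow> rot_less n x y) \<longleftrightarrow> (rot_sign 0 X \<longleftrightarrow> rot_less 0 y x)"
      if "X \<in> nsets {1..n} r" "x \<in> X" "y \<in> X" "x \<noteq> y" for X x y
      using s[OF that(1)] l[OF that(1)] that by auto
    show ?thesis
    proof
      assume "(A, B) \<in> sweep n"
      then show "(B, A) \<in> sweep 0" by (cases rule: sweepE) (use eq in \<open>auto intro!: sweepI\<close>)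
    next
      assume "(B, A) \<in> sweep 0"
      then show "(A, B) \<in> sweep n" by (cases rule: sweepE) (use eq in \<open>auto intro!: sweepI\<close>)
    qed
  qed
  then show ?thesis by auto
qed

text \<open>A discrete intermediate value argument: disjoint sets never both contain
  \<open>m + 1\<close>, so \<open>no_reversal\<close> would keep \<open>I\<close> below
  \<open>J\<close> throughout, against \<open>sweep_n\<close>.\<close>

lemma incomparable_aux:
  assumes "odd r" "I \<inter> J = {}" "(I, J) \<in> (sweep 0)\<^sup>+"
  shows "\<exists>m\<le>n. (I, J) \<notin> (sweep m)\<^sup>+ \<and> (J, I) \<notin> (sweep m)\<^sup>+"
proof (rule ccontr)
  assume contra: "\<not> ?thesis"
  have "m \<le> n \<Longrightarrow> (I, J) \<in> (sweep m)\<^sup>+" for m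
  proof (induction m)
    case 0
    then show ?case using assms by simp
  next
    case (Suc m)
    interpret layered_swap "sweep m" "sweep (Suc m)" "{A. Suc m \<in> A}" "layer m"
      using layered_swap_sweep Suc.prems by simp
    have "(J, I) \<notin> (sweep (Suc m))\<^sup>+"
      using no_reversal[of I J] Suc assms(2) acyclic_sweep[of m] by auto
    then show ?case using contra Suc.prems by blast
  qed
  from this[of n] have "(J, I) \<in> (sweep 0)\<^sup>+"
    using sweep_n[OF assms(1)] by (simp add: trancl_converse)
  then show False using assms(3) acyclic_sweep_0 by (meson acyclic_def trancl_trans)
qed

lemma incomparable:
  assumes "odd r" "I \<inter> J = {}"
  obtains m where "m \<le> n" "(I, J) \<notin> (sweep m)\<^sup>+" "(J, I) \<notin> (sweep m)\<^sup>+"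
proof -
  have "J \<inter> I = {}" using assms by auto
  then show ?thesis
    \<comment> \<open>If neither set is below the other at the start, \<open>m = 0\<close>
      serves.\<close>
    using that incomparable_aux[OF assms] incomparable_aux[OF assms(1), of J I] by blast
qed

section \<open>Extensions and fliples from down-sets\<close>

text \<open>Membership in \<open>D\<close> is the rotated sign; the factor \<open>parity m Y\<close>
  undoes the rotation. The new element \<open>m + 1\<close> is not moved and so contributes no
  negation.\<close>

definition one_ext :: "nat \<Rightarrow> nat set set \<Rightarrow> nat set \<Rightarrow> sign" where
  "one_ext m D = (\<lambda>X \<in> nsets {1..Suc n} r.
     let Y = set_del X (Suc m) in
     if Suc m \<in> X then if (Y \<in> D) \<noteq> parity m Y then Plus else Minus else \<sigma> Y)"

end

lemma set_del_insert: "set_del (insert k X) k = set_del X k"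
  unfolding set_del_def by auto

lemma skip_less: "skip k x < skip k y \<longleftrightarrow> x < y"
  unfolding skip_def by auto

lemma rot_less_skip: "rot_less m (skip (Suc m) x) (skip (Suc m) y) \<longleftrightarrow> rot_less m x y"
  unfolding rot_less_def skip_def by auto

lemma skip_image_subset:
  assumes "X \<subseteq> {1..n}" "k \<in> {1..Suc n}"
  shows "skip k ` X \<subseteq> {1..Suc n}"
  using assms by (force simp: skip_def)

lemma skip_nsets:
  assumes "X \<in> nsets {1..n} r" "k \<in> {1..Suc n}"
  shows "skip k ` X \<in> nsets {1..Suc n} r"
  using assms skip_image_subset[of X n k] card_image[OF inj_skip, of k X]
  by (simp add: nsets_def)

lemma insert_skip_nsets:
  assumes "X \<in> nsets {1..n} r" "k \<in> {1..Suc n}"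
  shows "insert k (skip k ` X) \<in> nsets {1..Suc n} (Suc r)"
proof -
  have "k \<notin> skip k ` X" by (metis imageE skip_neq)
  then show ?thesis using skip_nsets[OF assms] assms(2) by (simp add: nsets_def)
qed

lemma nsets_skip_cases:
  assumes W: "W \<in> nsets {1..Suc n} q" and k: "k \<in> {1..Suc n}"
  obtains (avoid) X where "X \<in> nsets {1..n} q" "W = skip k ` X"
  | (contain) X where "X \<in> nsets {1..n} (q - 1)" "q \<ge> 1" "W = insert k (skip k ` X)"
proof (cases "k \<in> W")
  case False
  then show ?thesis
    using avoid set_del_nsets[OF W k] image_set_del[of k W] by auto
next
  case True
  let ?V = "W - {k}"
  have V: "?V \<in> nsets {1..Suc n} (q - 1)" "q \<ge> 1"
    using W True by (auto simp: nsets_def Suc_le_eq card_gt_0_iff)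
  show ?thesis
    using contain[of "set_del ?V k"] set_del_nsets[OF V(1) k] image_set_del[of k ?V] V(2) True
    by (auto simp: insert_absorb)
qed

context signotope_on
begin

lemma one_ext_avoid:
  assumes "m \<le> n" "X \<in> nsets {1..n} r"
  shows "one_ext m D (skip (Suc m) ` X) = \<sigma> X"
proof -
  have "Suc m \<notin> skip (Suc m) ` X" by (metis imageE skip_neq)
  then show ?thesis
    using skip_nsets[OF assms(2), of "Suc m"] assms
    by (simp add: one_ext_def set_del_image)
qed

lemma one_ext_contain:
  assumes "m \<le> n" "Y \<in> nsets {1..n} (r - 1)" "r \<ge> 1"
  shows "one_ext m D (insert (Suc m) (skip (Suc m) ` Y)) = Plus \<longleftrightarrow> (Y \<in> D) \<noteq> parity m Y"
  using insert_skip_nsets[OF assms(2), of "Suc m"] assms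
  by (simp add: one_ext_def set_del_image set_del_insert)

text \<open>Sets avoiding the new element inherit the axiom from \<sigma>. For the others, the
  rotated sequence is \<open>rot_sign m X\<close> followed by the memberships of the
  \<open>X - {x}\<close> in \<open>D\<close>, which closure under \<open>sweep m\<close> makes
  monotone in the right direction.\<close>

lemma signotope_one_ext:
  assumes m: "m \<le> n" and r: "r \<ge> 1"
    and down: "\<And>A B. (A, B) \<in> sweep m \<Longrightarrow> B \<in> D \<Longrightarrow> A \<in> D"
  shows "signotope r (Suc n) (one_ext m D)"
  unfolding signotope_iff
proof (intro conjI ballI)
  show "one_ext m D \<in> nsets {1..Suc n} r \<rightarrow>\<^sub>E UNIV" by (simp add: one_ext_def)
next
  fix W
  assume W: "W \<in> nsets {1..Suc n} (Suc r)"
  let ?k = "Suc m" and ?f = "skip (Suc m)"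
  have k: "?k \<in> {1..Suc n}" using m by simp
  have diff: "?f ` X - {?f x} = ?f ` (X - {x})" for X x
    using inj_skip[of ?k UNIV] by (auto simp: inj_on_def)
  from W k show "alternation_free (<) W (\<lambda>x. one_ext m D (W - {x}) = Plus)"
  proof (cases rule: nsets_skip_cases)
    case (avoid X)
    have "alternation_free (<) X (\<lambda>x. \<sigma> (X - {x}) = Plus)"
      using signotope avoid(1) unfolding signotope_iff by blast
    moreover have "one_ext m D (W - {?f x}) = \<sigma> (X - {x})" if "x \<in> X" for x
      unfolding avoid(2) diff using avoid(1) that m
      by (intro one_ext_avoid) (auto simp: nsets_def)
    ultimately show ?thesis
      unfolding avoid(2)
      by (subst alternation_free_image[where L' = "(<)"])
        (auto simp: skip_less o_def avoid(2) cong: alternation_free_cong)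
  next
    case (contain X)
    have X: "X \<in> nsets {1..n} r" and finX: "finite X" using contain by (auto simp: nsets_def)
    have kX: "?k \<notin> ?f ` X" by (metis imageE skip_neq)
    \<comment> \<open>The rotated sign sequence of \<open>W\<close>, normalized by the global sign
      \<open>parity m X\<close>.\<close>
    define u where "u a = (((one_ext m D (W - {a}) = Plus) \<noteq> (a \<le> m)) \<noteq> parity m X)" for a
    have uk: "u ?k \<longleftrightarrow> rot_sign m X"
      using kX one_ext_avoid[OF m X] by (simp add: u_def contain(3) rot_sign_def)
    have uf: "u (?f x) \<longleftrightarrow> X - {x} \<in> D" if x: "x \<in> X" for x
    proof -
      have "X - {x} \<in> nsets {1..n} (r - 1)" using X x by (auto simp: nsets_def)
      moreover have "W - {?f x} = insert ?k (?f ` (X - {x}))"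
        using contain(3) diff[of X x] skip_neq[of ?k x] by auto
      ultimately have "one_ext m D (W - {?f x}) = Plus \<longleftrightarrow>
          (X - {x} \<in> D) \<noteq> (parity m X \<noteq> (x \<le> m))"
        using one_ext_contain[OF m _ r] parity_remove[OF finX x] by simp
      moreover have "?f x \<le> m \<longleftrightarrow> x \<le> m" by (auto simp: skip_def)
      ultimately show ?thesis unfolding u_def by auto
    qed
    have chain: "if rot_sign m X then u (?f y) \<longrightarrow> u (?f x) else u (?f x) \<longrightarrow> u (?f y)"
      if xy: "x \<in> X" "y \<in> X" "rot_less m x y" for x y
    proof -
      have ne: "x \<noteq> y" using xy(3) by (auto simp: rot_less_def)
      show ?thesis
      proof (cases "rot_sign m X")
        case True
        then have "(X - {x}, X - {y}) \<in> sweep m" using X xy ne by (intro sweepI) auto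
        then show ?thesis using True uf xy down by simp
      next
        case False
        then have "(X - {y}, X - {x}) \<in> sweep m"
          using X xy ne rot_less_total[OF ne] by (intro sweepI) auto
        then show ?thesis using False uf xy down by simp
      qed
    qed
    have "alternation_free (rot_less m) W u"
      unfolding alternation_free_def
    proof (intro ballI impI)
      fix a b c
      assume W: "a \<in> W" "b \<in> W" "c \<in> W" and l: "rot_less m a b" "rot_less m b c" and ac: "u a = u c"
      have ne: "a \<noteq> b" "b \<noteq> c" using l by (auto simp: rot_less_def)
      \<comment> \<open>The new element comes first in the rotated order, so only \<open>a\<close>
        can be equal to it.\<close>
      have "b \<noteq> ?k" using l(1) ne(1) rot_less_first[of a m] rot_less_total[of a b m] by auto
      then obtain y where y: "y \<in> X" "b = ?f y" using W contain(3) by auto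
      have "c \<noteq> ?k" using l(2) ne(2) rot_less_first[of b m] rot_less_total[of b c m] by auto
      then obtain z where z: "z \<in> X" "c = ?f z" using W contain(3) by auto
      have yz: "rot_less m y z" using l(2) y z by (simp add: rot_less_skip)
      show "u b = u a"
      proof (cases "a = ?k")
        case True
        then show ?thesis
          using ac chain[OF y(1) z(1) yz] y z uk by (simp split: if_splits)
      next
        case False
        then obtain x where x: "x \<in> X" "a = ?f x" using W contain(3) by auto
        have xy: "rot_less m x y" using l(1) x y by (simp add: rot_less_skip)
        show ?thesis
          using ac chain[OF x(1) y(1) xy] chain[OF y(1) z(1) yz] x y z
          by (auto split: if_splits)
      qed
    qed
    then show ?thesis
      unfolding u_def alternation_free_negate alternation_free_rotate .
  qed
qed

lemma signotope_del_one_ext: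
  assumes "m \<le> n"
  shows "signotope_del r (Suc n) (one_ext m D) (Suc m) = \<sigma>"
proof
  fix Y
  have ext: "\<sigma> \<in> nsets {1..n} r \<rightarrow>\<^sub>E UNIV" using signotope by (simp add: signotope_def)
  show "signotope_del r (Suc n) (one_ext m D) (Suc m) Y = \<sigma> Y"
  proof (cases "Y \<in> nsets {1..n} r")
    case True
    then show ?thesis using one_ext_avoid[OF assms True, of D] by (simp add: signotope_del_def)
  next
    case False
    then show ?thesis using PiE_arb[OF ext False] by (simp add: signotope_del_def)
  qed
qed

text \<open>Both \<open>D\<close> and \<open>insert I D\<close> are down-sets, and their extensions
  differ exactly at the set that restricts to \<open>I\<close>; between them they realize both signs
  there.\<close>

lemma fliple_one_ext:
  assumes m: "m \<le> n" and r: "r \<ge> 1" and I: "I \<in> nsets {1..n} (r - 1)" "I \<notin> D"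
    and down: "\<And>A B. (A, B) \<in> sweep m \<Longrightarrow> B \<in> D \<Longrightarrow> A \<in> D"
    and below: "\<And>A. (A, I) \<in> sweep m \<Longrightarrow> A \<in> D"
  shows "fliple r (Suc n) (one_ext m D) (insert (Suc m) (skip (Suc m) ` I))"
proof -
  let ?k = "Suc m"
  let ?F = "insert ?k (skip ?k ` I)"
  have F: "?F \<in> nsets {1..Suc n} r"
    using insert_skip_nsets[OF I(1), of ?k] m r by simp
  have s: "signotope r (Suc n) (one_ext m D)" "signotope r (Suc n) (one_ext m (insert I D))"
    using down below by (auto intro!: signotope_one_ext[OF m r])
  have other: "one_ext m (insert I D) X = one_ext m D X" if "X \<noteq> ?F" for X
  proof (cases "?k \<in> X")
    case True
    have "set_del X ?k \<noteq> I"
    proof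
      assume "set_del X ?k = I"
      then have "set_del (X - {?k}) ?k = I"
        using set_del_insert[of ?k "X - {?k}"] True by (simp add: insert_absorb)
      then have "X - {?k} = skip ?k ` I" using image_set_del[of ?k "X - {?k}"] by auto
      then show False using that True by auto
    qed
    then show ?thesis by (simp add: one_ext_def Let_def)
  next
    case False
    then show ?thesis by (simp add: one_ext_def Let_def)
  qed
  have "one_ext m (insert I D) ?F \<noteq> one_ext m D ?F"
    using one_ext_contain[OF m I(1) r, of D] one_ext_contain[OF m I(1) r, of "insert I D"] I(2)
    by auto
  then have "v = one_ext m D ?F \<or> v = one_ext m (insert I D) ?F" for v
    using sign_cases_neq by blast
  moreover have "(one_ext m D)(?F := one_ext m (insert I D) ?F) = one_ext m (insert I D)"
    using other by auto
  ultimately have "signotope r (Suc n) ((one_ext m D)(?F := v))" for v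
    using s by (metis fun_upd_triv)
  then show ?thesis using F by (simp add: fliple_def)
qed

end

theorem theorem2:
  fixes r n :: nat and \<sigma> :: "nat set \<Rightarrow> sign"
  assumes "odd r" and "r \<ge> 3" and "signotope r n \<sigma>"
  shows "extendable 2 r n \<sigma>"
proof -
  interpret signotope_on r n \<sigma> by unfold_locales (rule assms)
  have r: "r \<ge> 1" using assms by simp
  show ?thesis
    unfolding extendable_def
  proof (intro allI impI, elim conjE)
    fix I :: "nat \<Rightarrow> nat set"
    assume I: "\<forall>j \<in> {1..2}. I j \<in> nsets {1..n} (r - 1)" and disj: "disjoint_family_on I {1..2}"
    have "I 1 \<inter> I 2 = {}" using disj by (auto simp: disjoint_family_on_def)
    then obtain m where m: "m \<le> n" "(I 1, I 2) \<notin> (sweep m)\<^sup>+" "(I 2, I 1) \<notin> (sweep m)\<^sup>+"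
      using incomparable[OF assms(1)] by blast
    define D where "D = {A. \<exists>j \<in> {1..2}. (A, I j) \<in> (sweep m)\<^sup>+}"
    have two: "j = 1 \<or> j = 2" if "j \<in> {1..2}" for j :: nat using that by auto
    \<comment> \<open>Acyclicity keeps \<open>I j\<close> from lying below itself, incomparability
      from lying below the other set.\<close>
    have "I j \<notin> D" if "j \<in> {1..2}" for j
      using m acyclic_sweep[OF m(1)] two[OF that] two unfolding D_def acyclic_def by blast
    moreover have down: "A \<in> D" if "(A, B) \<in> sweep m" "B \<in> D" for A B
      using that unfolding D_def by (blast intro: trancl_into_trancl2)
    moreover have "A \<in> D" if "(A, I j) \<in> sweep m" "j \<in> {1..2}" for A j
      using that unfolding D_def by blast
    ultimately have flip: "\<forall>j \<in> {1..2}.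
        fliple r (Suc n) (one_ext m D) (insert (Suc m) (skip (Suc m) ` I j))"
      using I by (blast intro: fliple_one_ext[OF m(1) r])
    show "\<exists>k \<in> {1..n + 1}. \<exists>\<sigma>' I'.
        signotope r (n + 1) \<sigma>' \<and>
        (\<forall>j \<in> {1..2}. fliple r (n + 1) \<sigma>' (I' j)) \<and>
        signotope_del r (n + 1) \<sigma>' k = \<sigma> \<and>
        (\<forall>j \<in> {1..2}. set_del (I' j) k = I j)"
    proof (rule bexI[of _ "Suc m"], intro exI conjI)
      show "signotope r (n + 1) (one_ext m D)"
        using signotope_one_ext[OF m(1) r, of D] down by simp
      show "\<forall>j \<in> {1..2}. fliple r (n + 1) (one_ext m D) (insert (Suc m) (skip (Suc m) ` I j))"
        using flip by simp
      show "signotope_del r (n + 1) (one_ext m D) (Suc m) = \<sigma>"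
        using signotope_del_one_ext[OF m(1)] by simp
      show "\<forall>j \<in> {1..2}. set_del (insert (Suc m) (skip (Suc m) ` I j)) (Suc m) = I j"
        by (simp add: set_del_insert set_del_image)
      show "Suc m \<in> {1..n + 1}" using m by simp
    qed
  qed
qed

end
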